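(* Let $\mathcal{H}$ be a separable Hilbert space and let $W=\{(W_i,\omega_i)\}_{i\in I}$ be a Riesz fusion basis of $\mathcal{H}$, regarded as a $1$-uniform fusion frame (i.e. $\omega_i=1$ for all $i\in I$). Let $V=\{(V_i,\omega_i)\}_{i\in I}$ be an approximate alternate dual fusion frame of $W$. Then the sequence $\{(\psi_{vw}^{-1}V_i,\omega_i)\}_{i\in I}$ is an alternate dual fusion frame of $W$.
   Context: $I$ is a countable index set and $\pi_U$ is the orthogonal projection of $\mathcal{H}$ onto a closed subspace $U$. For closed subspaces $W_i\subseteq\mathcal{H}$ and weights $\omega_i>0$, $\{(W_i,\omega_i)\}_{i\in I}$ is a fusion frame if there are $0<A\le B<\infty$ with $A\|f\|^2\le\sum_{i\in I}\omega_i^2\|\pi_{W_i}f\|^2\le B\|f\|^2$ for all $f\in\mathcal{H}$; it is a Bessel fusion sequence if only the upper inequality is required. The fusion frame operator $S_Wf=\sum_{i\in I}\omega_i^2\pi_{W_i}f$ of a fusion frame is bounded, positive and invertible. A family of closed subspaces $\{W_i\}_{i\in I}$ is a Riesz fusion basis if it is complete (its closed linear span is $\mathcal{H}$) and there are constants $A,B>0$ such that $A\sum_{i\in J}\|f_i\|^2\le\|\sum_{i\in J}f_i\|^2\le B\sum_{i\in J}\|f_i\|^2$ for every finite $J\subset I$ and all $f_i\in W_i$. Every Riesz fusion basis is a $1$-uniform fusion frame (all weights equal to $1$). For a fusion frame $W=\{(W_i,\omega_i)\}$ and a Bessel fusion sequence $V=\{(V_i,\upsilon_i)\}$ put $\psi_{vw}f=\sum_{i\in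 I}\omega_i\upsilon_i\pi_{V_i}S_W^{-1}\pi_{W_i}f$, $f\in\mathcal{H}$, a bounded operator on $\mathcal{H}$. $V$ is an alternate dual (fusion frame) of $W$ if $\psi_{vw}=I_{\mathcal{H}}$, and an approximate alternate dual (fusion frame) of $W$ if $\|I_{\mathcal{H}}-\psi_{vw}\|<1$ (so $\psi_{vw}$ is then invertible). *)

theory Defs
  imports "HOL-Analysis.Analysis"
begin

text \<open>
  The scalar field of a Hilbert space, treated uniformly: the axioms below hold for the reals
  (with trivial conjugation) and for the complex numbers, and for no other fields, since they
  give \<open>x + conjugate x \<in> \<real>\<close> and \<open>x * conjugate x \<in> \<real>\<close>, so that every element is a root
  of a real quadratic polynomial.
\<close>

class real_or_complex = real_normed_field +
  fixes conjugate :: "'a \<Rightarrow> 'a"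
  assumes conjugate_add: "conjugate (x + y) = conjugate x + conjugate y"
    and conjugate_mult: "conjugate (x * y) = conjugate x * conjugate y"
    and mult_conjugate: "x * conjugate x = scaleR ((norm x)\<^sup>2) 1"

instantiation real :: real_or_complex
begin
definition conjugate_real :: "real \<Rightarrow> real" where "conjugate_real x = x"
instance
  by standard (simp_all add: conjugate_real_def power2_eq_square)
end

instantiation complex :: real_or_complex
begin
definition conjugate_complex :: "complex \<Rightarrow> complex" where "conjugate_complex = cnj"
instance
  by standard (simp_all add: conjugate_complex_def complex_norm_square scaleR_conv_of_real
      del: of_real_power)
end

text \<open>
  Completeness is part of the class \<^class>\<open>banach\<close>; the norm, and with it the topology and the
  infinite sums, is tied to the inner product by \<open>ip_self\<close>. The inner product is linear in its
  first argument.
\<close>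

locale separable_hilbert_space = vector_space scale
  for scale :: "'k::real_or_complex \<Rightarrow> 'h::banach \<Rightarrow> 'h" +
  fixes ip :: "'h \<Rightarrow> 'h \<Rightarrow> 'k"
  assumes scale_of_real: "scale (of_real r) x = r *\<^sub>R x"
    and ip_add_left: "ip (x + y) z = ip x z + ip y z"
    and ip_scale_left: "ip (scale c x) y = c * ip x y"
    and ip_commute: "ip x y = conjugate (ip y x)"
    and ip_self: "ip x x = of_real ((norm x)\<^sup>2)"
    and separable: "separable_space (euclidean :: 'h topology)"
begin

definition closed_subspace :: "'h set \<Rightarrow> bool" where
  "closed_subspace U \<longleftrightarrow> subspace U \<and> closed U"

definition orth_proj :: "'h set \<Rightarrow> 'h \<Rightarrow> 'h" where
  "orth_proj U f = (THE u. u \<in> U \<and> (\<forall>v\<in>U. ip (f - u) v = 0))"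

definition weighted_subspaces :: "'i set \<Rightarrow> ('i \<Rightarrow> 'h set) \<Rightarrow> ('i \<Rightarrow> real) \<Rightarrow> bool" where
  "weighted_subspaces I W \<omega> \<longleftrightarrow> (\<forall>i\<in>I. closed_subspace (W i) \<and> \<omega> i > 0)"

text \<open>
  The value of \<^const>\<open>infsum\<close> on a divergent family is \<open>0\<close>, so finiteness of the sums has to be
  required separately.
\<close>

definition bessel_fusion_sequence :: "'i set \<Rightarrow> ('i \<Rightarrow> 'h set) \<Rightarrow> ('i \<Rightarrow> real) \<Rightarrow> bool" where
  "bessel_fusion_sequence I W \<omega> \<longleftrightarrow> weighted_subspaces I W \<omega> \<and>
     (\<exists>B>0. \<forall>f. (\<lambda>i. (\<omega> i)\<^sup>2 * (norm (orth_proj (W i) f))\<^sup>2) summable_on I \<and>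
        (\<Sum>\<^sub>\<infinity>i\<in>I. (\<omega> i)\<^sup>2 * (norm (orth_proj (W i) f))\<^sup>2) \<le> B * (norm f)\<^sup>2)"

definition fusion_frame :: "'i set \<Rightarrow> ('i \<Rightarrow> 'h set) \<Rightarrow> ('i \<Rightarrow> real) \<Rightarrow> bool" where
  "fusion_frame I W \<omega> \<longleftrightarrow> weighted_subspaces I W \<omega> \<and>
     (\<exists>A B. 0 < A \<and> A \<le> B \<and>
       (\<forall>f. (\<lambda>i. (\<omega> i)\<^sup>2 * (norm (orth_proj (W i) f))\<^sup>2) summable_on I \<and>
          A * (norm f)\<^sup>2 \<le> (\<Sum>\<^sub>\<infinity>i\<in>I. (\<omega> i)\<^sup>2 * (norm (orth_proj (W i) f))\<^sup>2) \<and>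
          (\<Sum>\<^sub>\<infinity>i\<in>I. (\<omega> i)\<^sup>2 * (norm (orth_proj (W i) f))\<^sup>2) \<le> B * (norm f)\<^sup>2))"

definition riesz_fusion_basis :: "'i set \<Rightarrow> ('i \<Rightarrow> 'h set) \<Rightarrow> bool" where
  "riesz_fusion_basis I W \<longleftrightarrow> (\<forall>i\<in>I. closed_subspace (W i)) \<and>
     closure (span (\<Union>i\<in>I. W i)) = UNIV \<and>
     (\<exists>A B. 0 < A \<and> 0 < B \<and>
       (\<forall>J f. finite J \<and> J \<subseteq> I \<and> (\<forall>i\<in>J. f i \<in> W i) \<longrightarrow>
          A * (\<Sum>i\<in>J. (norm (f i))\<^sup>2) \<le> (norm (\<Sum>i\<in>J. f i))\<^sup>2 \<and>
          (norm (\<Sum>i\<in>J. f i))\<^sup>2 \<le> B * (\<Sum>i\<in>J. (norm (f i))\<^sup>2)))"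

definition frame_operator :: "'i set \<Rightarrow> ('i \<Rightarrow> 'h set) \<Rightarrow> ('i \<Rightarrow> real) \<Rightarrow> 'h \<Rightarrow> 'h" where
  "frame_operator I W \<omega> f = (\<Sum>\<^sub>\<infinity>i\<in>I. (\<omega> i)\<^sup>2 *\<^sub>R orth_proj (W i) f)"

definition psi :: "'i set \<Rightarrow> ('i \<Rightarrow> 'h set) \<Rightarrow> ('i \<Rightarrow> real) \<Rightarrow> ('i \<Rightarrow> 'h set) \<Rightarrow> ('i \<Rightarrow> real) \<Rightarrow> 'h \<Rightarrow> 'h" where
  "psi I V \<upsilon> W \<omega> f =
     (\<Sum>\<^sub>\<infinity>i\<in>I. (\<omega> i * \<upsilon> i) *\<^sub>R orth_proj (V i) (inv (frame_operator I W \<omega>) (orth_proj (W i) f)))"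

text \<open>
  In both notions of duality, the family of which \<open>(V, \<upsilon>)\<close> is a dual is required to be a fusion
  frame; otherwise the inverse of its frame operator need not make sense.
\<close>

definition alternate_dual ::
  "'i set \<Rightarrow> ('i \<Rightarrow> 'h set) \<Rightarrow> ('i \<Rightarrow> real) \<Rightarrow> ('i \<Rightarrow> 'h set) \<Rightarrow> ('i \<Rightarrow> real) \<Rightarrow> bool" where
  "alternate_dual I V \<upsilon> W \<omega> \<longleftrightarrow>
     fusion_frame I W \<omega> \<and> bessel_fusion_sequence I V \<upsilon> \<and> (\<forall>f. psi I V \<upsilon> W \<omega> f = f)"

definition approximate_alternate_dual ::
  "'i set \<Rightarrow> ('i \<Rightarrow> 'h set) \<Rightarrow> ('i \<Rightarrow> real) \<Rightarrow> ('i \<Rightarrow> 'h set) \<Rightarrow> ('i \<Rightarrow> real) \<Rightarrow> bool" where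
  "approximate_alternate_dual I V \<upsilon> W \<omega> \<longleftrightarrow>
     fusion_frame I W \<omega> \<and> bessel_fusion_sequence I V \<upsilon> \<and>
     onorm (\<lambda>f. f - psi I V \<upsilon> W \<omega> f) < 1"

end

text \<open>
  Both scalar fields occur: separable real Hilbert spaces of the library's class
  \<^class>\<open>real_inner\<close> are an instance, and so is the complex line.
\<close>

lemma separable_hilbert_space_real_inner:
  assumes "separable_space (euclidean :: 'a::{real_inner,banach} topology)"
  shows "separable_hilbert_space scaleR (inner :: 'a \<Rightarrow> 'a \<Rightarrow> real)"
  by unfold_locales
    (use assms in \<open>auto simp: inner_add_left inner_commute conjugate_real_def
       power2_norm_eq_inner algebra_simps\<close>)

lemma separable_hilbert_space_complex:
  "separable_hilbert_space (*) (\<lambda>x y :: complex. x * cnj y)"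
proof -
  obtain D :: "complex set"
    where D: "countable D" "\<And>X. open X \<Longrightarrow> X \<noteq> {} \<Longrightarrow> \<exists>d\<in>D. d \<in> X"
    using countable_dense_setE by blast
  have "closure D = UNIV"
    using D(2)[of "- closure D"] closure_subset[of D] by (metis ComplD Compl_empty_eq closed_closure
      double_complement open_Compl subsetD)
  with D(1) have "separable_space (euclidean :: complex topology)"
    unfolding separable_space_def by auto
  then show ?thesis
    by unfold_locales
      (auto simp: algebra_simps conjugate_complex_def scaleR_conv_of_real complex_norm_square
         simp del: of_real_power)
qed

end

theory Submission imports Defs begin

text \<open>
  Let \<open>S\<close> be the frame operator of \<open>W\<close> and \<open>\<psi>\<close> the operator \<open>psi\<close> of the pair. Since all weights are
  \<open>1\<close>, the identity \<open>S (S\<^sup>-\<^sup>1 w) = w\<close> expands \<open>w\<close> into the vectors \<open>\<pi>\<^sub>j S\<^sup>-\<^sup>1 w \<in> W j\<close>, where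
  \<open>\<pi>\<^sub>j\<close> projects onto \<open>W j\<close>. If \<open>w \<in> W i\<close>, then \<open>w\<close> itself is another such expansion, with a
  single term, and expansions along a Riesz fusion basis are unique. Hence
  \<open>\<pi>\<^sub>j S\<^sup>-\<^sup>1 w = 0\<close> for \<open>j \<noteq> i\<close> and \<open>\<pi>\<^sub>i S\<^sup>-\<^sup>1 w = w\<close> (\<open>orth_proj_inv_frame_operator\<close>), so that
  the series of \<open>\<psi> (S\<^sup>-\<^sup>1 w)\<close> reduces to one term, which lies in \<open>V i\<close>. In other words
  \<open>S\<^sup>-\<^sup>1 (W i) \<subseteq> \<psi>\<^sup>-\<^sup>1 (V i)\<close>. In the operator of the new pair the projections onto \<open>\<psi>\<^sup>-\<^sup>1 (V i)\<close>
  therefore act as the identity, and it equals \<open>\<Sum>\<^sub>i S\<^sup>-\<^sup>1 \<pi>\<^sub>i f = S\<^sup>-\<^sup>1 (S f) = f\<close>.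

  Two analytic facts support this computation. First, \<open>S\<close> and \<open>\<psi>\<close> are bounded and boundedly
  invertible: \<open>\<psi>\<close> and a multiple of \<open>S\<close> are at distance less than \<open>1\<close> from the identity
  (\<open>near_identity_invertible\<close>). Second, the spaces \<open>\<psi>\<^sup>-\<^sup>1 (V i)\<close> again form a Bessel sequence
  (\<open>bessel_vimage\<close>): the Bessel property is equivalent to a bound on finite sums of vectors from
  the subspaces, and such a bound survives an invertible operator.
\<close>

section \<open>Series dominated by a square-summable family, and operators close to the identity\<close>

text \<open>
  The tails of \<open>g\<close> tend to zero, so by the domination on finite sets the partial sums of \<open>f\<close>
  are Cauchy, although \<open>f\<close> need not be absolutely summable.
\<close>

lemma square_dominated_summable:
  fixes f :: "'i \<Rightarrow> 'b::banach" and g :: "'i \<Rightarrow> real"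
  assumes g: "g summable_on I" and nonneg: "\<And>i. i \<in> I \<Longrightarrow> 0 \<le> g i" and B: "0 < B"
    and dom: "\<And>J. finite J \<Longrightarrow> J \<subseteq> I \<Longrightarrow> (norm (sum f J))\<^sup>2 \<le> B * sum g J"
  shows "f summable_on I" and "(norm (infsum f I))\<^sup>2 \<le> B * infsum g I"
proof -
  have "\<exists>P. eventually P (finite_subsets_at_top I) \<and>
          (\<forall>F F'. P F \<and> P F' \<longrightarrow> dist (sum f F) (sum f F') < e)" if "e > 0" for e
  proof -
    define d where "d = (e/2)\<^sup>2 / B"
    have "d > 0" using that B by (simp add: d_def)
    then have "eventually (\<lambda>F. dist (sum g F) (infsum g I) < d) (finite_subsets_at_top I)"
      using infsum_tendsto[OF g] by (simp add: tendsto_iff)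
    then obtain F0 where F0: "finite F0" "F0 \<subseteq> I" "dist (sum g F0) (infsum g I) < d"
      unfolding eventually_finite_subsets_at_top by blast
    define P where "P F \<longleftrightarrow> finite F \<and> F \<subseteq> I \<and> F0 \<subseteq> F" for F
    have "eventually P (finite_subsets_at_top I)"
      unfolding eventually_finite_subsets_at_top P_def using F0 by blast
    moreover have tail: "norm (sum f F - sum f F0) < e/2" if "P F" for F
    proof -
      have F: "finite F" "F \<subseteq> I" "F0 \<subseteq> F" using that by (auto simp: P_def)
      have "sum g F \<le> infsum g I"
        using F nonneg by (intro finite_sum_le_infsum[OF g]) auto
      then have "sum g (F - F0) < d"
        using F0(3) F by (simp add: sum_diff dist_real_def)
      then have "B * sum g (F - F0) < (e/2)\<^sup>2"
        using B by (simp add: d_def field_simps)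
      moreover have "(norm (sum f (F - F0)))\<^sup>2 \<le> B * sum g (F - F0)"
        using F by (intro dom) auto
      ultimately have "(norm (sum f (F - F0)))\<^sup>2 < (e/2)\<^sup>2" by linarith
      then have "norm (sum f (F - F0)) < e/2"
        by (rule power2_less_imp_less) (use \<open>e > 0\<close> in simp)
      then show ?thesis using F by (simp add: sum_diff)
    qed
    have "dist (sum f F) (sum f F') < e" if "P F" "P F'" for F F'
      using tail[OF that(1)] tail[OF that(2)]
        norm_triangle_ineq4[of "sum f F - sum f F0" "sum f F' - sum f F0"]
      by (simp add: dist_norm)
    ultimately show ?thesis by blast
  qed
  then have "cauchy_filter (filtermap (sum f) (finite_subsets_at_top I))"
    by (simp add: cauchy_filter_metric_filtermap)
  moreover have "complete (UNIV::'b set)"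
    by (meson Cauchy_convergent UNIV_I complete_def convergent_def)
  ultimately obtain L where L: "(sum f \<longlongrightarrow> L) (finite_subsets_at_top I)"
    using complete_uniform[where S=UNIV] by (force simp add: filterlim_def)
  then have fL: "(f has_sum L) I" by (simp add: has_sum_def)
  then show "f summable_on I" by (auto simp: summable_on_def)
  have "(norm L)\<^sup>2 \<le> B * infsum g I"
  proof (rule tendsto_upperbound)
    show "((\<lambda>F. (norm (sum f F))\<^sup>2) \<longlongrightarrow> (norm L)\<^sup>2) (finite_subsets_at_top I)"
      by (intro tendsto_intros L)
    have "(norm (sum f F))\<^sup>2 \<le> B * infsum g I" if "finite F" "F \<subseteq> I" for F
    proof -
      have "sum g F \<le> infsum g I"
        using that nonneg by (intro finite_sum_le_infsum[OF g]) auto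
      then show ?thesis
        using dom[OF that] B by (meson mult_left_mono less_imp_le order_trans)
    qed
    then show "\<forall>\<^sub>F F in finite_subsets_at_top I. (norm (sum f F))\<^sup>2 \<le> B * infsum g I"
      by (intro eventually_finite_subsets_at_top_weakI)
  qed simp
  then show "(norm (infsum f I))\<^sup>2 \<le> B * infsum g I"
    using infsumI[OF fL] by simp
qed

text \<open>
  The equation \<open>T x = y\<close> says that \<open>x\<close> is a fixed point of the map \<open>x \<mapsto> x - T x + y\<close>, which is a
  contraction.
\<close>

lemma near_identity_invertible:
  fixes T :: "'b::banach \<Rightarrow> 'b"
  assumes T: "bounded_linear T" and q: "0 \<le> q" "q < 1"
    and near: "\<And>x. norm (x - T x) \<le> q * norm x"
  shows "surj T" and "(1 - q) * norm x \<le> norm (T x)"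
proof -
  interpret T: bounded_linear T by fact
  have "\<exists>x. y = T x" for y
  proof -
    have "\<exists>!x. x - T x + y = x"
    proof (rule banach_fix_type[OF q], intro allI)
      fix a b
      have "a - T a + y - (b - T b + y) = (a - b) - T (a - b)"
        by (simp add: T.diff)
      then show "dist (a - T a + y) (b - T b + y) \<le> q * dist a b"
        using near[of "a - b"] by (simp only: dist_norm)
    qed
    then obtain x where "x - T x + y = x" by blast
    then show ?thesis by (auto simp: algebra_simps)
  qed
  then show "surj T" by (auto simp: surj_def)
  show "(1 - q) * norm x \<le> norm (T x)"
    using near[of x] norm_triangle_ineq2[of x "T x"] by (simp add: algebra_simps)
qed

lemma conjugate_of_real: "conjugate (of_real r :: 'k::real_or_complex) = of_real r"
proof (cases "r = 0")
  case True
  then show ?thesis using conjugate_add[of "0::'k" 0] by simp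
next
  case False
  have "(of_real r :: 'k) * conjugate (of_real r) = of_real r * of_real r"
    by (simp add: mult_conjugate power2_eq_square scaleR_conv_of_real)
  then show ?thesis using False by simp
qed

context separable_hilbert_space
begin

section \<open>The underlying real inner product\<close>

text \<open>
  The real part of \<open>ip\<close>, recovered from the norm by polarization so that the definition is the
  same for real and for complex scalars. It is a real inner product with the same norm.
\<close>

definition re_ip :: "'h \<Rightarrow> 'h \<Rightarrow> real" where
  "re_ip x y = ((norm (x + y))\<^sup>2 - (norm x)\<^sup>2 - (norm y)\<^sup>2) / 2"

lemma ip_add_right: "ip x (y + z) = ip x y + ip x z"
  by (metis conjugate_add ip_add_left ip_commute)

lemma ip_scale_right: "ip x (scale c y) = conjugate c * ip x y"
  by (metis conjugate_mult ip_scale_left ip_commute)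

lemma of_real_re_ip: "of_real (2 * re_ip x y) = ip x y + ip y x"
proof -
  have "of_real ((norm (x + y))\<^sup>2) = ip (x + y) (x + y)" by (simp only: ip_self)
  also have "\<dots> = of_real ((norm x)\<^sup>2) + of_real ((norm y)\<^sup>2) + (ip x y + ip y x)"
    unfolding ip_self[symmetric] by (simp add: ip_add_left ip_add_right)
  finally show ?thesis by (simp add: re_ip_def)
qed

lemma re_ip_eqI:
  assumes "ip x y + ip y x = of_real (2 * r)"
  shows "re_ip x y = r"
proof -
  have "2 * re_ip x y = 2 * r"
    using assms of_real_re_ip[of x y] of_real_eq_iff by metis
  then show ?thesis by simp
qed

lemma re_ip_commute: "re_ip x y = re_ip y x"
  by (simp add: re_ip_def add.commute)

lemma re_ip_self: "re_ip x x = (norm x)\<^sup>2"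
  by (rule re_ip_eqI) (simp add: ip_self)

lemma re_ip_add_left: "re_ip (x + y) z = re_ip x z + re_ip y z"
proof (rule re_ip_eqI)
  have "ip (x + y) z + ip z (x + y) = (ip x z + ip z x) + (ip y z + ip z y)"
    by (simp add: ip_add_left ip_add_right)
  also have "\<dots> = of_real (2 * re_ip x z + 2 * re_ip y z)"
    by (simp only: of_real_re_ip[symmetric] of_real_add)
  finally show "ip (x + y) z + ip z (x + y) = of_real (2 * (re_ip x z + re_ip y z))"
    by (simp add: distrib_left)
qed

lemma re_ip_scaleR_left: "re_ip (r *\<^sub>R x) y = r * re_ip x y"
proof (rule re_ip_eqI)
  have "ip (r *\<^sub>R x) y + ip y (r *\<^sub>R x) = of_real r * (ip x y + ip y x)"
    by (simp add: scale_of_real[symmetric] ip_scale_left ip_scale_right conjugate_of_real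
        distrib_left)
  also have "\<dots> = of_real r * of_real (2 * re_ip x y)"
    by (simp only: of_real_re_ip)
  finally show "ip (r *\<^sub>R x) y + ip y (r *\<^sub>R x) = of_real (2 * (r * re_ip x y))"
    by (simp add: mult.left_commute)
qed

lemma re_ip_scaleR_right: "re_ip x (r *\<^sub>R y) = r * re_ip x y"
  using re_ip_scaleR_left[of r y x] by (simp add: re_ip_commute)

lemma norm_add_sq: "(norm (x + y))\<^sup>2 = (norm x)\<^sup>2 + 2 * re_ip x y + (norm y)\<^sup>2"
  by (simp add: re_ip_def field_simps)

lemma re_ip_minus_right: "re_ip x (- y) = - re_ip x y"
  using re_ip_scaleR_left[of "-1" y x] by (simp add: re_ip_commute)

lemma norm_diff_sq: "(norm (x - y))\<^sup>2 = (norm x)\<^sup>2 - 2 * re_ip x y + (norm y)\<^sup>2"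
  using norm_add_sq[of x "- y"] by (simp add: re_ip_minus_right)

lemma re_ip_Cauchy_Schwarz: "\<bar>re_ip x y\<bar> \<le> norm x * norm y"
proof -
  have le: "re_ip x y \<le> norm x * norm y" for x y
  proof -
    have "(norm (x + y))\<^sup>2 \<le> (norm x + norm y)\<^sup>2"
      by (intro power_mono norm_triangle_ineq) simp
    then show ?thesis by (simp add: norm_add_sq power2_sum)
  qed
  show ?thesis using le[of x y] le[of x "- y"] by (simp add: re_ip_minus_right)
qed

lemma bounded_linear_re_ip: "bounded_linear (\<lambda>x. re_ip x y)"
  by (rule bounded_linear_intro[where K = "norm y"])
     (simp_all add: re_ip_add_left re_ip_scaleR_left re_ip_Cauchy_Schwarz)

text \<open>
  For a subspace over the full scalar field, the real part detects orthogonality: multiplying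
  \<open>v\<close> by the scalar \<open>ip x v\<close> turns \<open>ip x v\<close> into its squared modulus, which is real.
\<close>

lemma orthogonal_iff_re_ip:
  assumes U: "subspace U"
  shows "(\<forall>v\<in>U. ip x v = 0) \<longleftrightarrow> (\<forall>v\<in>U. re_ip x v = 0)"
proof
  assume *: "\<forall>v\<in>U. ip x v = 0"
  show "\<forall>v\<in>U. re_ip x v = 0"
  proof
    fix v assume "v \<in> U"
    then have "ip x v = 0" "ip v x = 0"
      using * conjugate_of_real[of 0, where 'k = 'k] ip_commute[of v x] by auto
    then show "re_ip x v = 0" by (intro re_ip_eqI) simp
  qed
next
  assume *: "\<forall>v\<in>U. re_ip x v = 0"
  show "\<forall>v\<in>U. ip x v = 0"
  proof
    fix v assume v: "v \<in> U"
    define c where "c = ip x v"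
    have 1: "ip x (scale c v) = of_real ((norm c)\<^sup>2)"
      using mult_conjugate[of c]
      by (simp add: ip_scale_right c_def mult.commute scaleR_conv_of_real)
    then have 2: "ip (scale c v) x = of_real ((norm c)\<^sup>2)"
      using ip_commute[of "scale c v" x] by (simp add: conjugate_of_real del: of_real_power)
    have "re_ip x (scale c v) = (norm c)\<^sup>2"
      by (rule re_ip_eqI) (simp add: 1 2)
    then show "ip x v = 0"
      using * subspace_scale[OF U v, of c] by (simp add: c_def)
  qed
qed

lemma norm_scale: "norm (scale c x) = norm c * norm x"
proof -
  have "of_real ((norm (scale c x))\<^sup>2) = (c * conjugate c) * ip x x"
    unfolding ip_self[symmetric] by (simp add: ip_scale_left ip_scale_right)
  also have "\<dots> = of_real ((norm c * norm x)\<^sup>2)"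
    by (simp add: mult_conjugate ip_self scaleR_conv_of_real power_mult_distrib)
  finally have "(norm (scale c x))\<^sup>2 = (norm c * norm x)\<^sup>2"
    by (simp only: of_real_eq_iff)
  then show ?thesis by (simp add: power2_eq_iff_nonneg)
qed

lemma scale_scaleR: "scale c (r *\<^sub>R x) = r *\<^sub>R scale c x"
  by (simp add: scale_of_real[symmetric] mult.commute)

lemma bounded_linear_scale: "bounded_linear (scale c)"
  by (rule bounded_linear_intro[where K = "norm c"])
     (simp_all add: scale_right_distrib scale_scaleR norm_scale mult.commute)

section \<open>Orthogonal projections\<close>

lemma closed_subspaceD:
  assumes "closed_subspace U"
  shows "subspace U" "closed U" "0 \<in> U" "\<And>x y. x \<in> U \<Longrightarrow> y \<in> U \<Longrightarrow> x + y \<in> U"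
    "\<And>x y. x \<in> U \<Longrightarrow> y \<in> U \<Longrightarrow> x - y \<in> U" "\<And>c x. x \<in> U \<Longrightarrow> scale c x \<in> U"
    "\<And>r x. x \<in> U \<Longrightarrow> r *\<^sub>R x \<in> U"
proof -
  show U: "subspace U" and "closed U" using assms by (simp_all add: closed_subspace_def)
  show "0 \<in> U" by (rule subspace_0[OF U])
  show "x + y \<in> U" if "x \<in> U" "y \<in> U" for x y using U that by (rule subspace_add)
  show "x - y \<in> U" if "x \<in> U" "y \<in> U" for x y using U that by (rule subspace_diff)
  show "scale c x \<in> U" if "x \<in> U" for c x using U that by (rule subspace_scale)
  then show "r *\<^sub>R x \<in> U" if "x \<in> U" for r x
    using that scale_of_real[of r x] by metis
qed

text \<open>
  By the parallelogram law a minimizing sequence for the distance to \<open>f\<close> is Cauchy; at its limit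
  the distance is minimal, so its first variation in every direction of \<open>U\<close> vanishes.
\<close>

lemma projection_exists:
  assumes U: "closed_subspace U"
  shows "\<exists>u\<in>U. \<forall>v\<in>U. re_ip (f - u) v = 0"
proof -
  note Us = closed_subspaceD[OF U]
  define D where "D = (INF u\<in>U. (norm (f - u))\<^sup>2)"
  have bdd: "bdd_below ((\<lambda>u. (norm (f - u))\<^sup>2) ` U)"
    by (rule bdd_belowI[of _ 0]) auto
  have D_le: "D \<le> (norm (f - u))\<^sup>2" if "u \<in> U" for u
    unfolding D_def by (rule cINF_lower[OF bdd that])
  have "\<exists>u\<in>U. (norm (f - u))\<^sup>2 < D + 1 / real (Suc n)" for n
  proof -
    have "(INF u\<in>U. (norm (f - u))\<^sup>2) < D + 1 / real (Suc n)" by (simp add: D_def)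
    moreover have "U \<noteq> {}" using Us(3) by blast
    ultimately show ?thesis using cINF_less_iff[OF _ bdd] by blast
  qed
  then obtain u where u: "\<And>n. u n \<in> U" "\<And>n. (norm (f - u n))\<^sup>2 < D + 1 / real (Suc n)"
    by metis
  have close: "(norm (u m - u n))\<^sup>2 \<le> 2 / real (Suc m) + 2 / real (Suc n)" for m n
  proof -
    define a b where "a = f - u m" and "b = f - u n"
    \<comment> \<open>The midpoint is no closer to \<open>f\<close> than the infimum, which bounds \<open>\<parallel>a + b\<parallel>\<close> from below.\<close>
    have "(1/2) *\<^sub>R (u m + u n) \<in> U" by (intro Us u)
    then have "D \<le> (norm (f - (1/2) *\<^sub>R (u m + u n)))\<^sup>2" by (rule D_le)
    also have "f - (1/2) *\<^sub>R (u m + u n) = (1/2) *\<^sub>R (a + b)"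
    proof -
      have "a + b = (f + f) - (u m + u n)" by (simp add: a_def b_def)
      then show ?thesis by (simp only: scaleR_diff_right scaleR_half_double)
    qed
    also have "(norm \<dots>)\<^sup>2 = (norm (a + b))\<^sup>2 / 4"
      by (simp add: power_divide)
    finally have "4 * D \<le> (norm (a + b))\<^sup>2" by simp
    moreover have "(norm (a + b))\<^sup>2 + (norm (b - a))\<^sup>2 = 2 * (norm a)\<^sup>2 + 2 * (norm b)\<^sup>2"
      by (simp add: norm_add_sq norm_diff_sq re_ip_commute)
    moreover have "(norm a)\<^sup>2 < D + 1 / real (Suc m)" "(norm b)\<^sup>2 < D + 1 / real (Suc n)"
      using u(2)[of m] u(2)[of n] by (simp_all add: a_def b_def)
    ultimately have "(norm (b - a))\<^sup>2 \<le> 2 / real (Suc m) + 2 / real (Suc n)"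
      by linarith
    moreover have "u m - u n = b - a" by (simp add: a_def b_def)
    ultimately show ?thesis by (simp only:)
  qed
  have "Cauchy u"
  proof (rule metric_CauchyI)
    fix e :: real assume "0 < e"
    then obtain N where N: "inverse (real (Suc N)) < e\<^sup>2 / 4"
      using reals_Archimedean[of "e\<^sup>2 / 4"] by auto
    have "dist (u m) (u n) < e" if "m \<ge> N" "n \<ge> N" for m n
    proof -
      have "2 / real (Suc m) \<le> 2 / real (Suc N)" "2 / real (Suc n) \<le> 2 / real (Suc N)"
        using that by (auto intro!: divide_left_mono)
      then have "(norm (u m - u n))\<^sup>2 < e\<^sup>2"
        using close[of m n] N by (simp add: inverse_eq_divide)
      then show ?thesis
        using \<open>0 < e\<close> by (simp add: dist_norm power2_less_imp_less)
    qed
    then show "\<exists>M. \<forall>m\<ge>M. \<forall>n\<ge>M. dist (u m) (u n) < e" by blast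
  qed
  then obtain l where l: "u \<longlonglongrightarrow> l" by (auto simp: Cauchy_convergent_iff convergent_def)
  have lU: "l \<in> U" using Us(2) u(1) l by (rule closed_sequentially)
  have lD: "(norm (f - l))\<^sup>2 \<le> D"
  proof (rule LIMSEQ_le)
    show "(\<lambda>n. (norm (f - u n))\<^sup>2) \<longlonglongrightarrow> (norm (f - l))\<^sup>2" by (intro tendsto_intros l)
    show "(\<lambda>n. D + 1 / real (Suc n)) \<longlonglongrightarrow> D"
      using tendsto_add[OF tendsto_const LIMSEQ_Suc[OF lim_1_over_n], of D] by simp
    show "\<exists>N. \<forall>n\<ge>N. (norm (f - u n))\<^sup>2 \<le> D + 1 / real (Suc n)"
      using u(2) less_imp_le by blast
  qed
  have "re_ip (f - l) v = 0" if v: "v \<in> U" for v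
  proof (cases "v = 0")
    case True
    then show ?thesis by (simp add: re_ip_def)
  next
    case False
    define r where "r = re_ip (f - l) v"
    \<comment> \<open>The step along \<open>v\<close> that would decrease the distance most.\<close>
    define t where "t = r / (norm v)\<^sup>2"
    have "l + t *\<^sub>R v \<in> U" by (intro Us v lU)
    then have "(norm (f - l))\<^sup>2 \<le> (norm ((f - l) - t *\<^sub>R v))\<^sup>2"
      using lD order_trans[OF _ D_le[of "l + t *\<^sub>R v"]] by (simp only: diff_diff_eq)
    also have "\<dots> = (norm (f - l))\<^sup>2 - 2 * (t * r) + t\<^sup>2 * (norm v)\<^sup>2"
      by (simp add: norm_diff_sq re_ip_commute[of "f - l"] re_ip_scaleR_left r_def
          power_mult_distrib)
    finally have "2 * (t * r) \<le> t\<^sup>2 * (norm v)\<^sup>2" by simp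
    then have "r\<^sup>2 / (norm v)\<^sup>2 \<le> 0"
      using False by (simp add: t_def power2_eq_square)
    then show ?thesis using False
      by (simp add: r_def divide_le_0_iff zero_le_power2 power2_eq_iff)
  qed
  then show ?thesis using lU by blast
qed

lemma orth_proj_eqI:
  assumes U: "closed_subspace U" and u: "u \<in> U" "\<And>v. v \<in> U \<Longrightarrow> ip (f - u) v = 0"
  shows "orth_proj U f = u"
  unfolding orth_proj_def
proof (rule the_equality)
  show "u \<in> U \<and> (\<forall>v\<in>U. ip (f - u) v = 0)" using u by blast
next
  note Us = closed_subspaceD[OF U]
  fix w assume w: "w \<in> U \<and> (\<forall>v\<in>U. ip (f - w) v = 0)"
  have "w - u \<in> U" using w u Us by blast
  then have "ip (f - u) (w - u) = 0" "ip (f - w) (w - u) = 0" using w u by auto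
  moreover have "ip (f - u) (w - u) = ip (f - w) (w - u) + ip (w - u) (w - u)"
    by (simp flip: ip_add_left)
  ultimately have "ip (w - u) (w - u) = 0" by simp
  then show "w = u" by (simp add: ip_self)
qed

lemma
  assumes U: "closed_subspace U"
  shows orth_proj_in: "orth_proj U f \<in> U"
    and ip_orth_proj: "v \<in> U \<Longrightarrow> ip (f - orth_proj U f) v = 0"
proof -
  obtain u where u: "u \<in> U" "\<forall>v\<in>U. ip (f - u) v = 0"
    using projection_exists[OF U] orthogonal_iff_re_ip[OF closed_subspaceD(1)[OF U]] by metis
  then have "orth_proj U f = u" by (intro orth_proj_eqI[OF U]) auto
  with u show "orth_proj U f \<in> U" "v \<in> U \<Longrightarrow> ip (f - orth_proj U f) v = 0" by auto
qed

lemma re_ip_orth_proj: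
  assumes U: "closed_subspace U" and v: "v \<in> U"
  shows "re_ip (orth_proj U f) v = re_ip f v"
proof -
  have "re_ip (f - orth_proj U f) v = 0"
    using ip_orth_proj[OF U] orthogonal_iff_re_ip[OF closed_subspaceD(1)[OF U]] v by blast
  then show ?thesis using re_ip_add_left[of "f - orth_proj U f" "orth_proj U f" v] by simp
qed

lemma orth_proj_idem:
  assumes "closed_subspace U" "f \<in> U"
  shows "orth_proj U f = f"
  using orth_proj_eqI[OF assms] ip_scale_left[of 0] by simp

lemma norm_sq_orth_proj:
  assumes "closed_subspace U"
  shows "(norm (orth_proj U f))\<^sup>2 = re_ip f (orth_proj U f)"
  using re_ip_orth_proj[OF assms orth_proj_in[OF assms]] by (simp flip: re_ip_self)

lemma norm_orth_proj_le:
  assumes "closed_subspace U"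
  shows "norm (orth_proj U f) \<le> norm f"
proof -
  have "norm (orth_proj U f) * norm (orth_proj U f) \<le> norm f * norm (orth_proj U f)"
    using norm_sq_orth_proj[OF assms, of f] re_ip_Cauchy_Schwarz[of f "orth_proj U f"]
    by (simp add: power2_eq_square)
  then show ?thesis by (cases "norm (orth_proj U f) = 0") (auto simp: mult_le_cancel_right)
qed

lemma orth_proj_add:
  assumes U: "closed_subspace U"
  shows "orth_proj U (f + g) = orth_proj U f + orth_proj U g"
proof (rule orth_proj_eqI[OF U])
  show "orth_proj U f + orth_proj U g \<in> U"
    using orth_proj_in[OF U] closed_subspaceD(4)[OF U] by blast
  fix v assume v: "v \<in> U"
  have "f + g - (orth_proj U f + orth_proj U g) = (f - orth_proj U f) + (g - orth_proj U g)"
    by simp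
  then show "ip (f + g - (orth_proj U f + orth_proj U g)) v = 0"
    by (simp only: ip_add_left ip_orth_proj[OF U v] add_0)
qed

lemma orth_proj_scale:
  assumes U: "closed_subspace U"
  shows "orth_proj U (scale c f) = scale c (orth_proj U f)"
proof (rule orth_proj_eqI[OF U])
  show "scale c (orth_proj U f) \<in> U"
    using orth_proj_in[OF U] closed_subspaceD(6)[OF U] by blast
  fix v assume v: "v \<in> U"
  show "ip (scale c f - scale c (orth_proj U f)) v = 0"
    using ip_orth_proj[OF U v] by (simp add: ip_scale_left flip: scale_right_diff_distrib)
qed

section \<open>Bounded operators and their inverses\<close>

definition bounded_operator :: "('h \<Rightarrow> 'h) \<Rightarrow> bool" where
  "bounded_operator T \<longleftrightarrow> bounded_linear T \<and> (\<forall>c x. T (scale c x) = scale c (T x))"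

definition invertible_operator :: "('h \<Rightarrow> 'h) \<Rightarrow> bool" where
  "invertible_operator T \<longleftrightarrow>
     bounded_operator T \<and> surj T \<and> (\<exists>c>0. \<forall>x. c * norm x \<le> norm (T x))"

lemma bounded_operatorI:
  assumes "\<And>x y. T (x + y) = T x + T y" "\<And>c x. T (scale c x) = scale c (T x)"
    "\<And>x. norm (T x) \<le> K * norm x"
  shows "bounded_operator T"
proof -
  have "T (r *\<^sub>R x) = r *\<^sub>R T x" for r x
    using assms(2)[of "of_real r" x] by (simp add: scale_of_real)
  then show ?thesis
    unfolding bounded_operator_def
    using assms by (auto intro!: bounded_linear_intro[where K = K] simp: mult.commute)
qed

lemma invertible_operator_bij:
  assumes "invertible_operator T"
  shows "bij T"
proof -
  obtain c where T: "bounded_linear T" and c: "c > 0" "\<And>x. c * norm x \<le> norm (T x)"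
    using assms unfolding invertible_operator_def bounded_operator_def by blast
  interpret T: bounded_linear T by fact
  have "x = y" if "T x = T y" for x y
  proof -
    have "c * norm (x - y) \<le> 0" using c(2)[of "x - y"] that by (simp add: T.diff)
    then show ?thesis using c(1) by (simp add: mult_le_0_iff)
  qed
  then show ?thesis using assms unfolding invertible_operator_def by (auto simp: bij_def inj_def)
qed

lemma invertible_operator_inv:
  assumes T: "invertible_operator T"
  shows "bounded_operator (inv T)" and "T (inv T x) = x" and "inv T (T x) = x"
proof -
  have bij: "bij T" by (rule invertible_operator_bij[OF T])
  then show 1: "T (inv T x) = x" and 2: "inv T (T x) = x" for x
    by (auto simp: bij_def surj_f_inv_f)
  obtain c where bl: "bounded_linear T" and sc: "\<And>k x. T (scale k x) = scale k (T x)"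
    and c: "c > 0" "\<And>x. c * norm x \<le> norm (T x)"
    using T unfolding invertible_operator_def bounded_operator_def by blast
  interpret T: bounded_linear T by fact
  show "bounded_operator (inv T)"
  proof (rule bounded_operatorI)
    show "inv T (x + y) = inv T x + inv T y" for x y
      by (metis 1 2 T.add)
    show "inv T (scale k x) = scale k (inv T x)" for k x
      by (metis 1 2 sc)
    show "norm (inv T x) \<le> (1 / c) * norm x" for x
      using c(2)[of "inv T x"] c(1) by (simp add: 1 field_simps)
  qed
qed

section \<open>Bessel sequences through their synthesis operator\<close>

text \<open>
  Boundedness of the synthesis operator on finitely supported families. Unlike the Bessel
  inequality it does not mention projections, so it is easy to transport along an operator.
\<close>

definition synthesis_bound :: "'i set \<Rightarrow> ('i \<Rightarrow> 'h set) \<Rightarrow> ('i \<Rightarrow> real) \<Rightarrow> real \<Rightarrow> bool" where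
  "synthesis_bound I V \<upsilon> B \<longleftrightarrow> 0 < B \<and>
     (\<forall>J v. finite J \<and> J \<subseteq> I \<and> (\<forall>i\<in>J. v i \<in> V i) \<longrightarrow>
        (norm (\<Sum>i\<in>J. \<upsilon> i *\<^sub>R v i))\<^sup>2 \<le> B * (\<Sum>i\<in>J. (norm (v i))\<^sup>2))"

lemma synthesis_boundI:
  assumes "0 < B"
    and "\<And>J v. finite J \<Longrightarrow> J \<subseteq> I \<Longrightarrow> (\<And>i. i \<in> J \<Longrightarrow> v i \<in> V i) \<Longrightarrow>
      (norm (\<Sum>i\<in>J. \<upsilon> i *\<^sub>R v i))\<^sup>2 \<le> B * (\<Sum>i\<in>J. (norm (v i))\<^sup>2)"
  shows "synthesis_bound I V \<upsilon> B"
  unfolding synthesis_bound_def using assms(1) by (intro conjI allI impI assms(2)) auto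

lemma synthesis_boundD:
  assumes "synthesis_bound I V \<upsilon> B"
  shows "0 < B"
    and "finite J \<Longrightarrow> J \<subseteq> I \<Longrightarrow> (\<And>i. i \<in> J \<Longrightarrow> v i \<in> V i) \<Longrightarrow>
      (norm (\<Sum>i\<in>J. \<upsilon> i *\<^sub>R v i))\<^sup>2 \<le> B * (\<Sum>i\<in>J. (norm (v i))\<^sup>2)"
  using assms unfolding synthesis_bound_def by simp_all

lemma re_ip_sum_left: "re_ip (sum f J) y = (\<Sum>i\<in>J. re_ip (f i) y)"
  by (rule linear_sum) (rule bounded_linear.linear[OF bounded_linear_re_ip])

text \<open>
  Write \<open>g\<close> for the synthesized vector. Then \<open>\<parallel>g\<parallel>\<^sup>2\<close> is the sum of the inner products of
  \<open>g\<close> with the \<open>\<upsilon> i *\<^sub>R v i\<close>, where \<open>g\<close> may be replaced by its projections; Cauchy-Schwarz and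
  the Bessel inequality for \<open>g\<close> give \<open>\<parallel>g\<parallel>\<^sup>2 \<le> \<surd>B \<parallel>g\<parallel> \<surd>(\<Sum>\<parallel>v i\<parallel>\<^sup>2)\<close>.
\<close>

lemma bessel_imp_synthesis_bound:
  assumes "bessel_fusion_sequence I V \<upsilon>"
  shows "\<exists>B. synthesis_bound I V \<upsilon> B"
proof -
  from assms obtain B where B: "B > 0"
    and sm: "\<And>f. (\<lambda>i. (\<upsilon> i)\<^sup>2 * (norm (orth_proj (V i) f))\<^sup>2) summable_on I"
    and le: "\<And>f. (\<Sum>\<^sub>\<infinity>i\<in>I. (\<upsilon> i)\<^sup>2 * (norm (orth_proj (V i) f))\<^sup>2) \<le> B * (norm f)\<^sup>2"
    and V: "\<And>i. i \<in> I \<Longrightarrow> closed_subspace (V i)"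
    unfolding bessel_fusion_sequence_def weighted_subspaces_def by blast
  have bound: "(norm (\<Sum>i\<in>J. \<upsilon> i *\<^sub>R v i))\<^sup>2 \<le> B * (\<Sum>i\<in>J. (norm (v i))\<^sup>2)"
    if J: "finite J" "J \<subseteq> I" and v: "\<And>i. i \<in> J \<Longrightarrow> v i \<in> V i" for J v
  proof -
    define g where "g = (\<Sum>i\<in>J. \<upsilon> i *\<^sub>R v i)"
    define p where "p i = \<upsilon> i * norm (orth_proj (V i) g)" for i
    define s where "s = (\<Sum>i\<in>J. (norm (v i))\<^sup>2)"
    have "(\<Sum>i\<in>J. (p i)\<^sup>2) \<le> (\<Sum>\<^sub>\<infinity>i\<in>I. (p i)\<^sup>2)"
      using J sm[of g] by (intro finite_sum_le_infsum) (auto simp: p_def power_mult_distrib)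
    then have p: "(\<Sum>i\<in>J. (p i)\<^sup>2) \<le> B * (norm g)\<^sup>2"
      using le[of g] by (simp add: p_def power_mult_distrib)
    have "(norm g)\<^sup>2 = (\<Sum>i\<in>J. \<upsilon> i * re_ip (orth_proj (V i) g) (v i))"
    proof -
      have "(norm g)\<^sup>2 = (\<Sum>i\<in>J. re_ip (\<upsilon> i *\<^sub>R v i) g)"
        unfolding re_ip_sum_left[symmetric] g_def[symmetric] by (rule re_ip_self[symmetric])
      also have "\<dots> = (\<Sum>i\<in>J. \<upsilon> i * re_ip (orth_proj (V i) g) (v i))"
      proof (rule sum.cong[OF refl])
        fix i assume i: "i \<in> J"
        have "re_ip (orth_proj (V i) g) (v i) = re_ip g (v i)"
          using i J by (intro re_ip_orth_proj V v) auto
        then show "re_ip (\<upsilon> i *\<^sub>R v i) g = \<upsilon> i * re_ip (orth_proj (V i) g) (v i)"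
          by (simp only: re_ip_scaleR_left re_ip_commute[of "v i" g])
      qed
      finally show ?thesis .
    qed
    also have "\<dots> \<le> (\<Sum>i\<in>J. \<bar>p i\<bar> * \<bar>norm (v i)\<bar>)"
    proof (rule sum_mono)
      fix i
      have "\<upsilon> i * re_ip (orth_proj (V i) g) (v i) \<le> \<bar>\<upsilon> i\<bar> * \<bar>re_ip (orth_proj (V i) g) (v i)\<bar>"
        by (metis abs_ge_self abs_mult)
      also have "\<dots> \<le> \<bar>\<upsilon> i\<bar> * (norm (orth_proj (V i) g) * norm (v i))"
        by (intro mult_left_mono re_ip_Cauchy_Schwarz) simp
      finally show "\<upsilon> i * re_ip (orth_proj (V i) g) (v i) \<le> \<bar>p i\<bar> * \<bar>norm (v i)\<bar>"
        by (simp add: p_def abs_mult)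
    qed
    also have "\<dots> \<le> L2_set p J * L2_set (\<lambda>i. norm (v i)) J"
      by (rule L2_set_mult_ineq)
    also have "\<dots> = sqrt (\<Sum>i\<in>J. (p i)\<^sup>2) * sqrt s" by (simp add: L2_set_def s_def)
    also have "\<dots> \<le> sqrt (B * (norm g)\<^sup>2) * sqrt s"
      by (intro mult_right_mono real_sqrt_le_mono p) (simp add: s_def sum_nonneg)
    also have "\<dots> = norm g * sqrt (B * s)"
      by (simp add: real_sqrt_mult)
    finally have "norm g * norm g \<le> norm g * sqrt (B * s)" by (simp add: power2_eq_square)
    moreover have s0: "0 \<le> B * s" using B by (simp add: s_def sum_nonneg)
    ultimately have "norm g \<le> sqrt (B * s)"
      by (cases "g = 0") (simp_all add: mult_le_cancel_left)
    then have "(norm g)\<^sup>2 \<le> (sqrt (B * s))\<^sup>2" by (intro power_mono) auto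
    also have "\<dots> = B * s" using s0 by simp
    finally show ?thesis by (simp only: g_def s_def)
  qed
  show ?thesis by (rule exI, rule synthesis_boundI[OF B bound])
qed

text \<open>
  The same duality backwards: a partial sum \<open>s\<close> of the Bessel series of \<open>f\<close> is the inner product
  of \<open>f\<close> with a synthesized vector of squared norm at most \<open>B * s\<close>, so
  \<open>s\<^sup>2 \<le> \<parallel>f\<parallel>\<^sup>2 * B * s\<close>.
\<close>

lemma synthesis_bound_imp_bessel:
  assumes V: "weighted_subspaces I V \<upsilon>" and B: "synthesis_bound I V \<upsilon> B"
  shows "bessel_fusion_sequence I V \<upsilon>"
proof -
  have cs: "\<And>i. i \<in> I \<Longrightarrow> closed_subspace (V i)" and B0: "B > 0"
    using V synthesis_boundD(1)[OF B] by (auto simp: weighted_subspaces_def)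
  have partial: "(\<Sum>i\<in>J. (\<upsilon> i)\<^sup>2 * (norm (orth_proj (V i) f))\<^sup>2) \<le> B * (norm f)\<^sup>2"
    if J: "finite J" "J \<subseteq> I" for J f
  proof -
    define p where "p i = \<upsilon> i *\<^sub>R orth_proj (V i) f" for i
    define s where "s = (\<Sum>i\<in>J. (norm (p i))\<^sup>2)"
    have s0: "0 \<le> s" by (simp add: s_def sum_nonneg)
    have pV: "p i \<in> V i" if "i \<in> J" for i
      using that J cs closed_subspaceD(7) orth_proj_in by (auto simp: p_def subset_eq)
    have "s = (\<Sum>i\<in>J. re_ip (\<upsilon> i *\<^sub>R p i) f)"
      unfolding s_def
    proof (rule sum.cong[OF refl])
      fix i assume "i \<in> J"
      then have "closed_subspace (V i)" using J cs by auto
      then show "(norm (p i))\<^sup>2 = re_ip (\<upsilon> i *\<^sub>R p i) f"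
        by (simp add: p_def re_ip_commute[of _ f] re_ip_scaleR_right norm_sq_orth_proj[symmetric]
            power_mult_distrib) (simp add: power2_eq_square)
    qed
    also have "\<dots> = re_ip (\<Sum>i\<in>J. \<upsilon> i *\<^sub>R p i) f" by (simp add: re_ip_sum_left)
    also have "\<dots> \<le> norm (\<Sum>i\<in>J. \<upsilon> i *\<^sub>R p i) * norm f"
      using re_ip_Cauchy_Schwarz abs_le_D1 by blast
    finally have "s\<^sup>2 \<le> (norm (\<Sum>i\<in>J. \<upsilon> i *\<^sub>R p i) * norm f)\<^sup>2"
      using s0 by (intro power_mono)
    also have "\<dots> = (norm (\<Sum>i\<in>J. \<upsilon> i *\<^sub>R p i))\<^sup>2 * (norm f)\<^sup>2" by (simp add: power_mult_distrib)
    also have "\<dots> \<le> (B * s) * (norm f)\<^sup>2"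
      unfolding s_def by (intro mult_right_mono synthesis_boundD(2)[OF B J] pV) auto
    finally have "s * s \<le> s * (B * (norm f)\<^sup>2)" by (simp add: power2_eq_square mult_ac)
    then have "s \<le> B * (norm f)\<^sup>2"
      using s0 B0 by (cases "s = 0") (auto simp: mult_le_cancel_left)
    then show ?thesis by (simp add: s_def p_def power_mult_distrib)
  qed
  have sm: "(\<lambda>i. (\<upsilon> i)\<^sup>2 * (norm (orth_proj (V i) f))\<^sup>2) summable_on I" for f
    using partial by (intro nonneg_bounded_partial_sums_imp_summable_on[where C = "B * (norm f)\<^sup>2"]
        eventually_finite_subsets_at_top_weakI) auto
  then have "(\<Sum>\<^sub>\<infinity>i\<in>I. (\<upsilon> i)\<^sup>2 * (norm (orth_proj (V i) f))\<^sup>2) \<le> B * (norm f)\<^sup>2" for f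
    using partial by (intro infsum_le_finite_sums)
  with sm B0 V show ?thesis unfolding bessel_fusion_sequence_def by auto
qed

text \<open>
  \<open>T\<close> maps a vector synthesized from the spaces \<open>T -` V i\<close> to one synthesized from the \<open>V i\<close>, and
  it changes norms by factors bounded above and below.
\<close>

lemma bessel_vimage:
  assumes V: "bessel_fusion_sequence I V \<upsilon>" and T: "invertible_operator T"
  shows "bessel_fusion_sequence I (\<lambda>i. T -` V i) \<upsilon>"
proof -
  obtain B where B: "synthesis_bound I V \<upsilon> B"
    using bessel_imp_synthesis_bound[OF V] by blast
  obtain c where bl: "bounded_linear T" and sc: "\<And>k x. T (scale k x) = scale k (T x)"
    and c: "c > 0" "\<And>x. c * norm x \<le> norm (T x)"
    using T unfolding invertible_operator_def bounded_operator_def by blast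
  interpret T: bounded_linear T by fact
  obtain K where K: "K > 0" "\<And>x. norm (T x) \<le> norm x * K"
    using T.pos_bounded by blast
  have "closed_subspace (T -` V i)" if "closed_subspace (V i)" for i
  proof -
    have "subspace (T -` V i)"
      using closed_subspaceD[OF that] by (intro subspaceI) (simp_all add: T.add T.zero sc)
    moreover have "closed (T -` V i)"
      by (rule continuous_closed_vimage[OF closed_subspaceD(2)[OF that]])
         (rule linear_continuous_at[OF bl])
    ultimately show ?thesis by (simp add: closed_subspace_def)
  qed
  then have "weighted_subspaces I (\<lambda>i. T -` V i) \<upsilon>"
    using V by (auto simp: bessel_fusion_sequence_def weighted_subspaces_def)
  moreover have "synthesis_bound I (\<lambda>i. T -` V i) \<upsilon> (B * K\<^sup>2 / c\<^sup>2)"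
  proof (rule synthesis_boundI)
    have B0: "0 < B" by (rule synthesis_boundD(1)[OF B])
    then show "0 < B * K\<^sup>2 / c\<^sup>2" using K c by simp
    fix J v assume J: "finite J" "J \<subseteq> I" and v: "\<And>i. i \<in> J \<Longrightarrow> v i \<in> T -` V i"
    have "(c * norm (\<Sum>i\<in>J. \<upsilon> i *\<^sub>R v i))\<^sup>2 \<le> (norm (T (\<Sum>i\<in>J. \<upsilon> i *\<^sub>R v i)))\<^sup>2"
      using c by (intro power_mono) auto
    also have "\<dots> = (norm (\<Sum>i\<in>J. \<upsilon> i *\<^sub>R T (v i)))\<^sup>2"
      by (simp add: T.sum T.scaleR)
    also have "\<dots> \<le> B * (\<Sum>i\<in>J. (norm (T (v i)))\<^sup>2)"
      using v by (intro synthesis_boundD(2)[OF B J]) simp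
    also have "\<dots> \<le> B * (\<Sum>i\<in>J. (norm (v i) * K)\<^sup>2)"
      using B0 K by (intro mult_left_mono sum_mono power_mono) auto
    also have "(\<Sum>i\<in>J. (norm (v i) * K)\<^sup>2) = (\<Sum>i\<in>J. (norm (v i))\<^sup>2) * K\<^sup>2"
      by (simp only: power_mult_distrib sum_distrib_right)
    finally have "(c * norm (\<Sum>i\<in>J. \<upsilon> i *\<^sub>R v i))\<^sup>2 \<le> B * ((\<Sum>i\<in>J. (norm (v i))\<^sup>2) * K\<^sup>2)" .
    then show "(norm (\<Sum>i\<in>J. \<upsilon> i *\<^sub>R v i))\<^sup>2 \<le> B * K\<^sup>2 / c\<^sup>2 * (\<Sum>i\<in>J. (norm (v i))\<^sup>2)"
      using c(1) by (simp only: power_mult_distrib) (simp add: field_simps)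
  qed
  ultimately show ?thesis by (rule synthesis_bound_imp_bessel)
qed

text \<open>
  Both the frame operator and \<open>psi\<close> arise by applying the synthesis operator of a Bessel sequence
  to a bounded family of analysis operators \<open>L i\<close>.
\<close>

lemma bounded_operator_synthesis:
  assumes B: "synthesis_bound I V \<upsilon> B"
    and L: "\<And>i f. i \<in> I \<Longrightarrow> L i f \<in> V i"
    and L_add: "\<And>i f g. i \<in> I \<Longrightarrow> L i (f + g) = L i f + L i g"
    and L_scale: "\<And>i c f. i \<in> I \<Longrightarrow> L i (scale c f) = scale c (L i f)"
    and sm: "\<And>f. (\<lambda>i. (norm (L i f))\<^sup>2) summable_on I"
    and le: "\<And>f. (\<Sum>\<^sub>\<infinity>i\<in>I. (norm (L i f))\<^sup>2) \<le> C * (norm f)\<^sup>2"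
  shows "bounded_operator (\<lambda>f. \<Sum>\<^sub>\<infinity>i\<in>I. \<upsilon> i *\<^sub>R L i f)"
    and "(\<lambda>i. \<upsilon> i *\<^sub>R L i f) summable_on I"
proof -
  note B0 = synthesis_boundD(1)[OF B]
  have part: "(norm (\<Sum>i\<in>J. \<upsilon> i *\<^sub>R L i f))\<^sup>2 \<le> B * (\<Sum>i\<in>J. (norm (L i f))\<^sup>2)"
    if "finite J" "J \<subseteq> I" for f J
    using that L by (intro synthesis_boundD(2)[OF B]) auto
  have sL: "(\<lambda>i. \<upsilon> i *\<^sub>R L i f) summable_on I" for f
    by (rule square_dominated_summable(1)[OF sm[of f] zero_le_power2 B0 part])
  have norm_le: "(norm (\<Sum>\<^sub>\<infinity>i\<in>I. \<upsilon> i *\<^sub>R L i f))\<^sup>2 \<le> B * (\<Sum>\<^sub>\<infinity>i\<in>I. (norm (L i f))\<^sup>2)" for f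
    by (rule square_dominated_summable(2)[OF sm[of f] zero_le_power2 B0 part])
  show "(\<lambda>i. \<upsilon> i *\<^sub>R L i f) summable_on I" by (rule sL)
  show "bounded_operator (\<lambda>f. \<Sum>\<^sub>\<infinity>i\<in>I. \<upsilon> i *\<^sub>R L i f)"
  proof (rule bounded_operatorI)
    fix f g
    show "(\<Sum>\<^sub>\<infinity>i\<in>I. \<upsilon> i *\<^sub>R L i (f + g)) = (\<Sum>\<^sub>\<infinity>i\<in>I. \<upsilon> i *\<^sub>R L i f) + (\<Sum>\<^sub>\<infinity>i\<in>I. \<upsilon> i *\<^sub>R L i g)"
      by (subst infsum_add[OF sL sL, symmetric])
         (auto intro!: infsum_cong simp: L_add scaleR_add_right)
  next
    fix c f
    have "(\<Sum>\<^sub>\<infinity>i\<in>I. \<upsilon> i *\<^sub>R L i (scale c f)) = (\<Sum>\<^sub>\<infinity>i\<in>I. scale c (\<upsilon> i *\<^sub>R L i f))"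
      by (auto intro!: infsum_cong simp: L_scale scale_scaleR)
    also have "\<dots> = scale c (\<Sum>\<^sub>\<infinity>i\<in>I. \<upsilon> i *\<^sub>R L i f)"
      by (intro infsumI has_sum_bounded_linear[OF bounded_linear_scale] has_sum_infsum sL)
    finally show "(\<Sum>\<^sub>\<infinity>i\<in>I. \<upsilon> i *\<^sub>R L i (scale c f)) = scale c (\<Sum>\<^sub>\<infinity>i\<in>I. \<upsilon> i *\<^sub>R L i f)" .
  next
    fix f
    have "(norm (\<Sum>\<^sub>\<infinity>i\<in>I. \<upsilon> i *\<^sub>R L i f))\<^sup>2 \<le> B * (C * (norm f)\<^sup>2)"
      using norm_le[of f] mult_left_mono[OF le[of f], of B] B0 by linarith
    also have "\<dots> \<le> B * (\<bar>C\<bar> * (norm f)\<^sup>2)"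
      using B0 by (intro mult_left_mono mult_right_mono) auto
    also have "\<dots> = (sqrt (B * \<bar>C\<bar>) * norm f)\<^sup>2"
      using B0 by (simp add: power_mult_distrib)
    finally show "norm (\<Sum>\<^sub>\<infinity>i\<in>I. \<upsilon> i *\<^sub>R L i f) \<le> sqrt (B * \<bar>C\<bar>) * norm f"
      by (rule power2_le_imp_le) (use B0 in simp)
  qed
qed

section \<open>The frame operator and the operator of a pair of sequences\<close>

lemma fusion_frame_imp_bessel:
  assumes "fusion_frame I W \<omega>"
  shows "bessel_fusion_sequence I W \<omega>"
proof -
  obtain A B where "weighted_subspaces I W \<omega>" "0 < A" "A \<le> B"
    "\<forall>f. (\<lambda>i. (\<omega> i)\<^sup>2 * (norm (orth_proj (W i) f))\<^sup>2) summable_on I \<and>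
          (\<Sum>\<^sub>\<infinity>i\<in>I. (\<omega> i)\<^sup>2 * (norm (orth_proj (W i) f))\<^sup>2) \<le> B * (norm f)\<^sup>2"
    using assms unfolding fusion_frame_def by blast
  moreover have "B > 0" using calculation by linarith
  ultimately show ?thesis unfolding bessel_fusion_sequence_def by blast
qed

lemma frame_operator_bounded:
  assumes "bessel_fusion_sequence I W \<omega>"
  shows "bounded_operator (frame_operator I W \<omega>)"
    and "(\<lambda>i. (\<omega> i)\<^sup>2 *\<^sub>R orth_proj (W i) f) summable_on I"
proof -
  obtain B where B: "synthesis_bound I W \<omega> B"
    using bessel_imp_synthesis_bound[OF assms] by blast
  obtain C where W: "\<And>i. i \<in> I \<Longrightarrow> closed_subspace (W i)"
    and sm: "\<And>f. (\<lambda>i. (\<omega> i)\<^sup>2 * (norm (orth_proj (W i) f))\<^sup>2) summable_on I"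
    and le: "\<And>f. (\<Sum>\<^sub>\<infinity>i\<in>I. (\<omega> i)\<^sup>2 * (norm (orth_proj (W i) f))\<^sup>2) \<le> C * (norm f)\<^sup>2"
    using assms unfolding bessel_fusion_sequence_def weighted_subspaces_def by blast
  define L where "L i f = \<omega> i *\<^sub>R orth_proj (W i) f" for i f
  have eq: "\<omega> i *\<^sub>R L i f = (\<omega> i)\<^sup>2 *\<^sub>R orth_proj (W i) f" for i f
    by (simp add: L_def power2_eq_square)
  have "L i f \<in> W i" if "i \<in> I" for i f
    using W[OF that] orth_proj_in closed_subspaceD(7) by (auto simp: L_def)
  moreover have "L i (f + g) = L i f + L i g" "L i (scale c f) = scale c (L i f)"
    if "i \<in> I" for i f g c
    using W[OF that] by (simp_all add: L_def orth_proj_add orth_proj_scale scaleR_add_right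
        scale_scaleR)
  ultimately have "bounded_operator (\<lambda>f. \<Sum>\<^sub>\<infinity>i\<in>I. \<omega> i *\<^sub>R L i f)"
    "(\<lambda>i. \<omega> i *\<^sub>R L i f) summable_on I" for f
    using bounded_operator_synthesis[OF B, of L C] sm le
    by (auto simp: L_def power_mult_distrib)
  then show "bounded_operator (frame_operator I W \<omega>)"
    "(\<lambda>i. (\<omega> i)\<^sup>2 *\<^sub>R orth_proj (W i) f) summable_on I"
    by (simp_all add: eq frame_operator_def[abs_def])
qed

text \<open>
  The lower frame bound says \<open>A \<parallel>f\<parallel>\<^sup>2 \<le> \<langle>S f, f\<rangle>\<close>. With \<open>\<parallel>S f\<parallel> \<le> K \<parallel>f\<parallel>\<close> this gives
  \<open>\<parallel>f - t S f\<parallel>\<^sup>2 \<le> (1 - 2 t A + t\<^sup>2 K\<^sup>2) \<parallel>f\<parallel>\<^sup>2\<close>, which is least at \<open>t = A / K\<^sup>2\<close>; there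
  \<open>t S\<close> is close to the identity.
\<close>

lemma frame_operator_invertible:
  assumes "fusion_frame I W \<omega>"
  shows "invertible_operator (frame_operator I W \<omega>)"
proof -
  let ?S = "frame_operator I W \<omega>"
  note bes = fusion_frame_imp_bessel[OF assms]
  note bo = frame_operator_bounded[OF bes]
  have bl: "bounded_linear ?S" using bo(1) by (simp add: bounded_operator_def)
  interpret S: bounded_linear ?S by fact
  obtain A where A: "A > 0"
    and lower: "\<And>f. A * (norm f)\<^sup>2 \<le> (\<Sum>\<^sub>\<infinity>i\<in>I. (\<omega> i)\<^sup>2 * (norm (orth_proj (W i) f))\<^sup>2)"
    and W: "\<And>i. i \<in> I \<Longrightarrow> closed_subspace (W i)"
    using assms unfolding fusion_frame_def weighted_subspaces_def by blast
  have pos: "A * (norm f)\<^sup>2 \<le> re_ip (?S f) f" for f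
  proof -
    have "re_ip (?S f) f = (\<Sum>\<^sub>\<infinity>i\<in>I. re_ip ((\<omega> i)\<^sup>2 *\<^sub>R orth_proj (W i) f) f)"
      unfolding frame_operator_def
      by (intro infsumI[symmetric] has_sum_bounded_linear[OF bounded_linear_re_ip]
          has_sum_infsum bo(2))
    also have "\<dots> = (\<Sum>\<^sub>\<infinity>i\<in>I. (\<omega> i)\<^sup>2 * (norm (orth_proj (W i) f))\<^sup>2)"
      using W by (intro infsum_cong) (simp add: re_ip_commute[of _ f] re_ip_scaleR_right
          norm_sq_orth_proj)
    finally show ?thesis using lower[of f] by simp
  qed
  obtain K0 where K0: "\<And>f. norm (?S f) \<le> norm f * K0" using S.bounded by blast
  \<comment> \<open>Taking \<open>K \<ge> A\<close> keeps the radicand in \<open>q\<close> nonnegative, also in the zero space.\<close>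
  define K where "K = max K0 A"
  have K: "K \<ge> A" "K > 0" "norm (?S f) \<le> K * norm f" for f
    using A K0[of f] mult_left_mono[of K0 K "norm f"] by (auto simp: K_def mult.commute)
  define t where "t = A / K\<^sup>2"
  define q where "q = sqrt (1 - (A / K)\<^sup>2)"
  have t0: "t > 0" using A K by (simp add: t_def)
  have AK: "0 < A / K" "A / K \<le> 1" using A K by auto
  then have AK2: "(A / K)\<^sup>2 \<le> 1" "(A / K)\<^sup>2 > 0" by (auto simp: power_le_one)
  then have q: "0 \<le> q" "q < 1" by (auto simp: q_def)
  have near: "norm (f - t *\<^sub>R ?S f) \<le> q * norm f" for f
  proof (rule power2_le_imp_le)
    have "(norm (f - t *\<^sub>R ?S f))\<^sup>2
        = (norm f)\<^sup>2 - 2 * (t * re_ip (?S f) f) + t\<^sup>2 * (norm (?S f))\<^sup>2"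
      by (simp add: norm_diff_sq re_ip_commute[of f] re_ip_scaleR_left power_mult_distrib)
    also have "\<dots> \<le> (norm f)\<^sup>2 - 2 * (t * (A * (norm f)\<^sup>2)) + t\<^sup>2 * (K * norm f)\<^sup>2"
      using t0 pos[of f] K by (intro add_mono diff_mono mult_left_mono power_mono) auto
    also have "\<dots> = (1 - (A / K)\<^sup>2) * (norm f)\<^sup>2"
      using K by (simp add: t_def field_simps power2_eq_square)
    also have "\<dots> = (q * norm f)\<^sup>2"
      using AK2 by (simp add: q_def power_mult_distrib)
    finally show "(norm (f - t *\<^sub>R ?S f))\<^sup>2 \<le> (q * norm f)\<^sup>2" .
  qed (use q in simp)
  have blt: "bounded_linear (\<lambda>f. t *\<^sub>R ?S f)"
    by (rule bounded_linear_compose[OF bounded_linear_scaleR_right bl])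
  note inv = near_identity_invertible[OF blt q near]
  have "surj ?S"
  proof (rule surjI)
    fix y
    have "t *\<^sub>R ?S (inv (\<lambda>f. t *\<^sub>R ?S f) (t *\<^sub>R y)) = t *\<^sub>R y"
      by (rule surj_f_inv_f[OF inv(1)])
    then show "?S (inv (\<lambda>f. t *\<^sub>R ?S f) (t *\<^sub>R y)) = y" using t0 by simp
  qed
  moreover have "(1 - q) / t * norm f \<le> norm (?S f)" for f
    using inv(2)[of f] t0 by (simp add: field_simps)
  moreover have "(1 - q) / t > 0" using q t0 by simp
  ultimately show ?thesis using bo(1) unfolding invertible_operator_def by blast
qed

text \<open>
  The analysis operators \<open>\<omega> i *\<^sub>R \<pi>\<^bsub>V i\<^esub> S\<^sup>-\<^sup>1 \<pi>\<^bsub>W i\<^esub>\<close> inherit square summability from the Bessel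
  inequality of \<open>W\<close>, because the outer projection is a contraction and \<open>S\<^sup>-\<^sup>1\<close> is bounded.
\<close>

lemma psi_bounded:
  assumes W: "fusion_frame I W \<omega>" and V: "bessel_fusion_sequence I V \<upsilon>"
  shows "bounded_operator (psi I V \<upsilon> W \<omega>)"
proof -
  let ?R = "inv (frame_operator I W \<omega>)"
  have R: "bounded_linear ?R" "\<And>c x. ?R (scale c x) = scale c (?R x)"
    using invertible_operator_inv(1)[OF frame_operator_invertible[OF W]]
    by (auto simp: bounded_operator_def)
  interpret R: bounded_linear ?R by (rule R)
  obtain B where B: "synthesis_bound I V \<upsilon> B"
    using bessel_imp_synthesis_bound[OF V] by blast
  obtain C where Wc: "\<And>i. i \<in> I \<Longrightarrow> closed_subspace (W i)"
    and sm: "\<And>f. (\<lambda>i. (\<omega> i)\<^sup>2 * (norm (orth_proj (W i) f))\<^sup>2) summable_on I"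
    and le: "\<And>f. (\<Sum>\<^sub>\<infinity>i\<in>I. (\<omega> i)\<^sup>2 * (norm (orth_proj (W i) f))\<^sup>2) \<le> C * (norm f)\<^sup>2"
    using fusion_frame_imp_bessel[OF W]
    unfolding bessel_fusion_sequence_def weighted_subspaces_def by blast
  have Vc: "\<And>i. i \<in> I \<Longrightarrow> closed_subspace (V i)"
    using V unfolding bessel_fusion_sequence_def weighted_subspaces_def by blast
  obtain K where K: "K > 0" "\<And>x. norm (?R x) \<le> norm x * K" using R.pos_bounded by blast
  define L where "L i f = \<omega> i *\<^sub>R orth_proj (V i) (?R (orth_proj (W i) f))" for i f
  define b where "b i f = (\<omega> i)\<^sup>2 * (norm (orth_proj (W i) f))\<^sup>2" for i f
  have L_le: "(norm (L i f))\<^sup>2 \<le> K\<^sup>2 * b i f" if "i \<in> I" for i f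
  proof -
    have "norm (orth_proj (V i) (?R (orth_proj (W i) f))) \<le> norm (orth_proj (W i) f) * K"
      using norm_orth_proj_le[OF Vc[OF that]] K(2) order_trans by blast
    then have "(norm (orth_proj (V i) (?R (orth_proj (W i) f))))\<^sup>2 \<le> (norm (orth_proj (W i) f) * K)\<^sup>2"
      by (intro power_mono) auto
    then have "(\<omega> i)\<^sup>2 * (norm (orth_proj (V i) (?R (orth_proj (W i) f))))\<^sup>2
        \<le> (\<omega> i)\<^sup>2 * (norm (orth_proj (W i) f) * K)\<^sup>2"
      by (intro mult_left_mono) auto
    then show ?thesis by (simp add: L_def b_def power_mult_distrib mult_ac)
  qed
  have sb: "(\<lambda>i. K\<^sup>2 * b i f) summable_on I" for f
    using sm[of f] by (intro summable_on_cmult_right) (simp add: b_def)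
  have sL: "(\<lambda>i. (norm (L i f))\<^sup>2) summable_on I" for f
    using L_le by (intro summable_on_comparison_test[OF sb]) auto
  have leL: "(\<Sum>\<^sub>\<infinity>i\<in>I. (norm (L i f))\<^sup>2) \<le> (K\<^sup>2 * C) * (norm f)\<^sup>2" for f
  proof -
    have "(\<Sum>\<^sub>\<infinity>i\<in>I. (norm (L i f))\<^sup>2) \<le> (\<Sum>\<^sub>\<infinity>i\<in>I. K\<^sup>2 * b i f)"
      using L_le by (intro infsum_mono sL sb)
    also have "\<dots> = K\<^sup>2 * (\<Sum>\<^sub>\<infinity>i\<in>I. b i f)" by (rule infsum_cmult_right')
    also have "\<dots> \<le> K\<^sup>2 * (C * (norm f)\<^sup>2)"
      using le[of f] by (intro mult_left_mono) (auto simp: b_def)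
    finally show ?thesis by (simp add: mult_ac)
  qed
  have "L i f \<in> V i" if "i \<in> I" for i f
    using Vc[OF that] orth_proj_in closed_subspaceD(7) by (auto simp: L_def)
  moreover have "L i (f + g) = L i f + L i g" "L i (scale c f) = scale c (L i f)"
    if "i \<in> I" for i f g c
    using Wc[OF that] Vc[OF that]
    by (simp_all add: L_def orth_proj_add orth_proj_scale scaleR_add_right scale_scaleR R.add R(2))
  ultimately have "bounded_operator (\<lambda>f. \<Sum>\<^sub>\<infinity>i\<in>I. \<upsilon> i *\<^sub>R L i f)"
    by (intro bounded_operator_synthesis(1)[OF B _ _ _ sL leL])
  then show ?thesis by (simp add: psi_def[abs_def] L_def mult.commute)
qed

lemma psi_invertible:
  assumes "approximate_alternate_dual I V \<upsilon> W \<omega>"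
  shows "invertible_operator (psi I V \<upsilon> W \<omega>)"
proof -
  let ?\<psi> = "psi I V \<upsilon> W \<omega>"
  have bo: "bounded_operator ?\<psi>" and less: "onorm (\<lambda>f. f - ?\<psi> f) < 1"
    using assms psi_bounded unfolding approximate_alternate_dual_def by auto
  then have bl: "bounded_linear ?\<psi>" by (simp add: bounded_operator_def)
  then have blI: "bounded_linear (\<lambda>f. f - ?\<psi> f)" by (intro bounded_linear_sub bounded_linear_ident)
  note inv = near_identity_invertible[OF bl onorm_pos_le[OF blI] less onorm[OF blI]]
  then show ?thesis
    using bo less unfolding invertible_operator_def by (metis diff_gt_0_iff_gt)
qed

section \<open>Riesz fusion bases\<close>

text \<open>
  Applied to the difference \<open>g\<close> of two expansions of the same vector, this says that expansions
  along a Riesz fusion basis are unique. Up to a constant, the lower Riesz inequality bounds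
  \<open>\<parallel>g j\<parallel>\<^sup>2\<close> by the squared norms of the partial sums of \<open>g\<close>, which tend to zero.
\<close>

lemma riesz_expansion_unique:
  assumes W: "riesz_fusion_basis I W" and g: "\<And>j. j \<in> I \<Longrightarrow> g j \<in> W j"
    and sum0: "(g has_sum 0) I" and j: "j \<in> I"
  shows "g j = 0"
proof -
  obtain A where A: "A > 0" and lower: "\<And>J. finite J \<Longrightarrow> J \<subseteq> I \<Longrightarrow>
      A * (\<Sum>i\<in>J. (norm (g i))\<^sup>2) \<le> (norm (\<Sum>i\<in>J. g i))\<^sup>2"
    using W g unfolding riesz_fusion_basis_def by (meson subsetD)
  have "A * (norm (g j))\<^sup>2 \<le> 0"
  proof (rule tendsto_lowerbound)
    have "(sum g \<longlongrightarrow> 0) (finite_subsets_at_top I)" using sum0 by (simp add: has_sum_def)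
    then have "((\<lambda>J. (norm (sum g J))\<^sup>2) \<longlongrightarrow> (norm (0::'h))\<^sup>2) (finite_subsets_at_top I)"
      by (intro tendsto_intros)
    then show "((\<lambda>J. (norm (sum g J))\<^sup>2) \<longlongrightarrow> 0) (finite_subsets_at_top I)" by simp
    have "A * (norm (g j))\<^sup>2 \<le> (norm (sum g J))\<^sup>2" if "finite J" "{j} \<subseteq> J" "J \<subseteq> I" for J
    proof -
      have "(norm (g j))\<^sup>2 \<le> (\<Sum>i\<in>J. (norm (g i))\<^sup>2)"
        using that by (intro member_le_sum) auto
      then show ?thesis
        using lower[of J] that A by (meson mult_left_mono less_imp_le order_trans)
    qed
    then show "\<forall>\<^sub>F J in finite_subsets_at_top I. A * (norm (g j))\<^sup>2 \<le> (norm (sum g J))\<^sup>2"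
      unfolding eventually_finite_subsets_at_top using j by (intro exI[of _ "{j}"]) auto
  qed simp
  then show ?thesis using A by (simp add: mult_le_0_iff)
qed

text \<open>
  Biorthogonality: \<open>w\<close> has the expansion \<open>\<Sum>\<^sub>j \<pi>\<^bsub>W j\<^esub> (S\<^sup>-\<^sup>1 w)\<close> because \<open>S (S\<^sup>-\<^sup>1 w) = w\<close>, and also the
  trivial one whose only term is \<open>w\<close>.
\<close>

lemma orth_proj_inv_frame_operator:
  assumes W: "riesz_fusion_basis I W" and \<omega>: "\<And>i. i \<in> I \<Longrightarrow> \<omega> i = 1"
    and ff: "fusion_frame I W \<omega>" and i: "i \<in> I" and w: "w \<in> W i" and j: "j \<in> I"
  shows "orth_proj (W j) (inv (frame_operator I W \<omega>) w) = (if j = i then w else 0)"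
proof -
  let ?f = "inv (frame_operator I W \<omega>) w"
  have cs: "closed_subspace (W k)" if "k \<in> I" for k
    using W that by (simp add: riesz_fusion_basis_def)
  have "((\<lambda>k. (\<omega> k)\<^sup>2 *\<^sub>R orth_proj (W k) ?f) has_sum frame_operator I W \<omega> ?f) I"
    unfolding frame_operator_def[of I W \<omega> ?f]
    by (intro has_sum_infsum frame_operator_bounded(2) fusion_frame_imp_bessel ff)
  then have "((\<lambda>k. (\<omega> k)\<^sup>2 *\<^sub>R orth_proj (W k) ?f) has_sum w) I"
    by (simp only: invertible_operator_inv(2)[OF frame_operator_invertible[OF ff]])
  then have 1: "((\<lambda>k. orth_proj (W k) ?f) has_sum w) I"
    using \<omega> by (simp cong: has_sum_cong)
  have "((\<lambda>k. if k = i then - w else 0) has_sum - w) I"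
    using has_sum_finite_neutralI[of "{i}" I "\<lambda>k. if k = i then - w else 0"] i by auto
  then have "((\<lambda>k. orth_proj (W k) ?f + (if k = i then - w else 0)) has_sum w + - w) I"
    by (rule has_sum_add[OF 1])
  moreover have "orth_proj (W k) ?f + (if k = i then - w else 0) \<in> W k" if "k \<in> I" for k
    using w orth_proj_in[OF cs[OF that]] closed_subspaceD(5)[OF cs[OF that], of _ w]
    by (cases "k = i") auto
  ultimately have "orth_proj (W j) ?f + (if j = i then - w else 0) = 0"
    using j by (intro riesz_expansion_unique[OF W]) simp_all
  then show ?thesis by (simp split: if_splits)
qed

text \<open>
  By biorthogonality only the term of index \<open>i\<close> survives in the series of \<open>psi\<close>. The right-hand
  side is a vector of \<open>V i\<close>, so \<open>psi\<close> maps \<open>S\<^sup>-\<^sup>1 (W i)\<close> into \<open>V i\<close>.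
\<close>

lemma psi_inv_frame_operator:
  assumes W: "riesz_fusion_basis I W" and \<omega>: "\<And>i. i \<in> I \<Longrightarrow> \<omega> i = 1"
    and ff: "fusion_frame I W \<omega>" and V: "\<And>i. i \<in> I \<Longrightarrow> closed_subspace (V i)"
    and i: "i \<in> I" and w: "w \<in> W i"
  shows "psi I V \<omega> W \<omega> (inv (frame_operator I W \<omega>) w)
       = orth_proj (V i) (inv (frame_operator I W \<omega>) w)"
proof -
  let ?R = "inv (frame_operator I W \<omega>)"
  have R0: "?R 0 = 0"
    using invertible_operator_inv(1)[OF frame_operator_invertible[OF ff]]
    unfolding bounded_operator_def by (simp add: bounded_linear.linear linear_0)
  have "psi I V \<omega> W \<omega> (?R w) = (\<Sum>\<^sub>\<infinity>j\<in>I. if j = i then orth_proj (V i) (?R w) else 0)"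
    unfolding psi_def
    using orth_proj_inv_frame_operator[OF W \<omega> ff i w] \<omega> V closed_subspaceD(3)
    by (intro infsum_cong) (auto simp: R0 orth_proj_idem)
  also have "\<dots> = orth_proj (V i) (?R w)"
    using has_sum_finite_neutralI[of "{i}" I "\<lambda>j. if j = i then orth_proj (V i) (?R w) else 0"] i
    by (intro infsumI) auto
  finally show ?thesis .
qed

lemma riesz_alternate_dual_of_approximate:
  assumes W: "riesz_fusion_basis I W" and \<omega>: "\<And>i. i \<in> I \<Longrightarrow> \<omega> i = 1"
    and dual: "approximate_alternate_dual I V \<omega> W \<omega>"
  shows "alternate_dual I (\<lambda>i. inv (psi I V \<omega> W \<omega>) ` V i) \<omega> W \<omega>"
proof -
  let ?\<psi> = "psi I V \<omega> W \<omega>" and ?S = "frame_operator I W \<omega>"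
  have ff: "fusion_frame I W \<omega>" and bV: "bessel_fusion_sequence I V \<omega>"
    using dual by (auto simp: approximate_alternate_dual_def)
  have inv: "invertible_operator ?\<psi>" by (rule psi_invertible[OF dual])
  \<comment> \<open>As preimages the new subspaces are closed by continuity of \<open>psi\<close>.\<close>
  have img: "inv ?\<psi> ` V i = ?\<psi> -` V i" for i
    by (rule bij_vimage_eq_inv_image[OF invertible_operator_bij[OF inv], symmetric])
  have bU: "bessel_fusion_sequence I (\<lambda>i. ?\<psi> -` V i) \<omega>"
    by (rule bessel_vimage[OF bV inv])
  have cV: "\<And>i. i \<in> I \<Longrightarrow> closed_subspace (V i)"
    and cU: "\<And>i. i \<in> I \<Longrightarrow> closed_subspace (?\<psi> -` V i)"
    using bV bU by (auto simp: bessel_fusion_sequence_def weighted_subspaces_def)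
  have cW: "\<And>i. i \<in> I \<Longrightarrow> closed_subspace (W i)"
    using W by (simp add: riesz_fusion_basis_def)
  have invS: "invertible_operator ?S" by (rule frame_operator_invertible[OF ff])
  then have bl: "bounded_linear (inv ?S)"
    using invertible_operator_inv(1) by (auto simp: bounded_operator_def)
  have "psi I (\<lambda>i. ?\<psi> -` V i) \<omega> W \<omega> f = f" for f
  proof -
    \<comment> \<open>These vectors are therefore fixed by the projections onto the new subspaces.\<close>
    have mem: "inv ?S (orth_proj (W i) f) \<in> ?\<psi> -` V i" if "i \<in> I" for i
      using psi_inv_frame_operator[OF W \<omega> ff cV that orth_proj_in[OF cW[OF that]]]
        orth_proj_in[OF cV[OF that]] by simp
    have "psi I (\<lambda>i. ?\<psi> -` V i) \<omega> W \<omega> f = (\<Sum>\<^sub>\<infinity>i\<in>I. inv ?S ((\<omega> i)\<^sup>2 *\<^sub>R orth_proj (W i) f))"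
      unfolding psi_def[of I "\<lambda>i. ?\<psi> -` V i" \<omega> W \<omega> f]
      using orth_proj_idem[OF cU mem] \<omega> by (intro infsum_cong) simp
    also have "\<dots> = inv ?S (?S f)"
      unfolding frame_operator_def[of I W \<omega> f]
      by (intro infsumI has_sum_bounded_linear[OF bl] has_sum_infsum
          frame_operator_bounded(2) fusion_frame_imp_bessel ff)
    also have "\<dots> = f" by (rule invertible_operator_inv(3)[OF invS])
    finally show ?thesis .
  qed
  then show ?thesis using ff bU unfolding alternate_dual_def img by blast
qed

end

theorem theorem2p5:
  fixes scale :: "'k::real_or_complex \<Rightarrow> 'h::banach \<Rightarrow> 'h"
    and ip :: "'h \<Rightarrow> 'h \<Rightarrow> 'k"
    and I :: "'i set"
    and W V :: "'i \<Rightarrow> 'h set"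
    and \<omega> :: "'i \<Rightarrow> real"
  assumes "separable_hilbert_space scale ip"
    and "countable I"
    and "separable_hilbert_space.riesz_fusion_basis scale I W"
    and "\<And>i. i \<in> I \<Longrightarrow> \<omega> i = 1"
    and "separable_hilbert_space.approximate_alternate_dual scale ip I V \<omega> W \<omega>"
  shows "separable_hilbert_space.alternate_dual scale ip I
           (\<lambda>i. inv (separable_hilbert_space.psi ip I V \<omega> W \<omega>) ` V i) \<omega> W \<omega>"
  using separable_hilbert_space.riesz_alternate_dual_of_approximate[OF assms(1,3,4,5)] .

end
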